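(* Let $K$ be a number field with ring of integers $\mathcal{O}_K$, and let $\{\alpha_i \bmod I_i\}_{i=1}^k$ be an exact covering system of $\mathcal{O}_K$. Suppose $I_i$ is division maximal in $\{I_1,\dots,I_k\}$. Then $I_i$ is repeated at least $\min\{N(\mathfrak{p}) \mid \mathfrak{p} \text{ a prime ideal},\ \mathfrak{p} \mid I_i\}$ times, i.e. $\#\{t\in\{1,\dots,k\} \mid I_t = I_i\} \ge \min\{N(\mathfrak{p}) \mid \mathfrak{p}\mid I_i \text{ prime}\}$.
   Context: For $\alpha\in\mathcal{O}_K$ and a nonzero ideal $I\neq\mathcal{O}_K$ of $\mathcal{O}_K$, $\alpha \bmod I$ denotes the set $\alpha+I$. A finite family $\{\alpha_i \bmod I_i\}_{i=1}^k$ (with each $I_i$ a nonzero proper ideal) is an exact covering system of $\mathcal{O}_K$ if every element of $\mathcal{O}_K$ belongs to exactly one of the sets $\alpha_i+I_i$. For a nonzero ideal $\mathcal{I}$, $N(\mathcal{I})=|\mathcal{O}_K/\mathcal{I}|$. An ideal $I$ in a set $\mathcal{I}=\{I_1,\dots,I_k\}$ of ideals is division maximal if $J\in\mathcal{I}$ and $I\mid J$ (i.e. $J\subseteq I$) imply $I=J$. *)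

theory Defs
  imports "HOL-Algebra.Algebraic_Closure_Type"
begin

text \<open>
  A number field is a subfield of some ambient field of characteristic 0 (which may be the field
  itself) that has finite degree over the rationals.
\<close>

definition number_field :: "'a::field_char_0 set \<Rightarrow> bool"
  where "number_field K \<longleftrightarrow>
    subfield K ring_of_type_algebra \<and> ring.finite_dimension ring_of_type_algebra \<rat> K"

definition ring_of_integers :: "'a::field_char_0 set \<Rightarrow> 'a ring"
  where "ring_of_integers K = ring_of_type_algebra \<lparr> carrier := {x \<in> K. algebraic_int x} \<rparr>"

definition exact_covering_system ::
    "('a, 'b) ring_scheme \<Rightarrow> nat \<Rightarrow> (nat \<Rightarrow> 'a) \<Rightarrow> (nat \<Rightarrow> 'a set) \<Rightarrow> bool"
  where "exact_covering_system R k \<alpha> I \<longleftrightarrow>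
    (\<forall>i\<in>{1..k}. \<alpha> i \<in> carrier R \<and> ideal (I i) R \<and> I i \<noteq> {\<zero>\<^bsub>R\<^esub>} \<and> I i \<noteq> carrier R) \<and>
    (\<forall>x\<in>carrier R. \<exists>!i. i \<in> {1..k} \<and> x \<in> \<alpha> i <+\<^bsub>R\<^esub> I i)"

text \<open>
  As usual, an infinite quotient would have norm 0; nonzero ideals of rings of integers
  have finite quotients.
\<close>

definition ideal_norm :: "('a, 'b) ring_scheme \<Rightarrow> 'a set \<Rightarrow> nat"
  where "ideal_norm R I = card (carrier (R Quot I))"

text \<open>Divisibility of ideals is reverse inclusion: \<open>I\<close> divides \<open>J\<close> iff \<open>J \<subseteq> I\<close>.\<close>

definition ideal_dvd :: "'a set \<Rightarrow> 'a set \<Rightarrow> bool"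
  where "ideal_dvd I J \<longleftrightarrow> J \<subseteq> I"

definition division_maximal :: "'a set \<Rightarrow> 'a set set \<Rightarrow> bool"
  where "division_maximal I \<I> \<longleftrightarrow> I \<in> \<I> \<and> (\<forall>J\<in>\<I>. ideal_dvd I J \<longrightarrow> I = J)"

end

theory Submission
  imports Defs "Jordan_Normal_Form.Char_Poly"
begin

text \<open>
  By B. H. Neumann's lemma all ideals of an exact cover have finite index. Let \<open>I = I\<^sub>i\<close>, let \<open>L\<close> be
  the intersection of all \<open>I\<^sub>t\<close>, and let \<open>F\<^sub>t(x)\<close> be the number of cosets of \<open>L\<close> in
  \<open>(x + I) \<inter> (\<alpha>\<^sub>t + I\<^sub>t)\<close>. The \<open>F\<^sub>t\<close> add up to a constant, \<open>F\<^sub>t\<close> is invariant under translation by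
  \<open>I + I\<^sub>t\<close>, and \<open>F\<^sub>t\<close> is a multiple of the indicator of \<open>\<alpha>\<^sub>t + I\<close> if \<open>I\<^sub>t = I\<close>.

  For each prime \<open>p\<close> associated to \<open>I\<close> let \<open>h\<^sub>p\<close> lie in the \<open>p\<close>-part of the socle of \<open>\<O>\<^sub>K / I\<close>. This part
  is one-dimensional over \<open>\<O>\<^sub>K / p\<close>, so if \<open>I\<^sub>t \<noteq> I\<close>, then \<open>I + I\<^sub>t\<close>, being strictly larger than \<open>I\<close>
  by maximality, contains some \<open>h\<^sub>p\<close>. Hence the alternating sum of \<open>F\<^sub>t(\<alpha>\<^sub>i + \<Sum>\<^sub>p\<^sub>\<in>\<^sub>S h\<^sub>p)\<close> over all sets \<open>S\<close>
  of associated primes vanishes, as does that of a constant. If \<open>I\<close> were repeated fewer than \<open>N(p)\<close>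
  times for every \<open>p\<close>, then the \<open>h\<^sub>p\<close> could be chosen so that only \<open>S = \<emptyset>\<close>, \<open>t = i\<close> contributes to the
  remaining sums, a contradiction.

  One-dimensionality holds because the localisation of \<open>\<O>\<^sub>K\<close> at \<open>p\<close> is a valuation ring: if \<open>x\<close> is a
  root of a primitive integer polynomial with coefficients \<open>c\<^sub>k\<close>, then the Horner partial sums \<open>y\<^sub>k\<close>
  and \<open>x y\<^sub>k\<close> are algebraic integers, and \<open>y\<^sub>k - x y\<^sub>k\<^sub>+\<^sub>1 = c\<^sub>k \<notin> p\<close> for some \<open>k\<close>.
\<close>

section \<open>Cosets of additive subgroups\<close>

definition coset :: "'a::ab_group_add set \<Rightarrow> 'a \<Rightarrow> 'a set"
  where "coset H x = {y. y - x \<in> H}"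

definition add_subgroup :: "'a::ab_group_add set \<Rightarrow> bool"
  where "add_subgroup H \<longleftrightarrow> 0 \<in> H \<and> (\<forall>x\<in>H. \<forall>y\<in>H. x - y \<in> H)"

text \<open>Cosets are counted by representatives in \<open>G\<close>, which makes sense for any
  \<open>H\<close>; in particular the empty intersection \<open>UNIV\<close> has finite
  index.\<close>

definition finite_index :: "'a::ab_group_add set \<Rightarrow> 'a set \<Rightarrow> bool"
  where "finite_index G H \<longleftrightarrow> finite (coset H ` G)"

lemma add_subgroup_zero: "add_subgroup H \<Longrightarrow> 0 \<in> H"
  and add_subgroup_diff: "add_subgroup H \<Longrightarrow> x \<in> H \<Longrightarrow> y \<in> H \<Longrightarrow> x - y \<in> H"
  by (auto simp: add_subgroup_def)

lemma add_subgroup_uminus: "add_subgroup H \<Longrightarrow> x \<in> H \<Longrightarrow> - x \<in> H"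
  using add_subgroup_diff[of H 0 x] add_subgroup_zero[of H] by simp

lemma add_subgroup_add: "add_subgroup H \<Longrightarrow> x \<in> H \<Longrightarrow> y \<in> H \<Longrightarrow> x + y \<in> H"
  using add_subgroup_diff[of H x "- y"] add_subgroup_uminus[of H y] by simp

lemma add_subgroup_sum:
  assumes "add_subgroup H" "\<And>x. x \<in> A \<Longrightarrow> f x \<in> H"
  shows "sum f A \<in> H"
  using assms(2)
  by (induction A rule: infinite_finite_induct)
    (auto intro: add_subgroup_zero add_subgroup_add assms(1))

lemma add_subgroup_Inter:
  assumes "\<And>H. H \<in> \<H> \<Longrightarrow> add_subgroup H"
  shows "add_subgroup (\<Inter>\<H>)"
  using assms by (auto simp: add_subgroup_def)

lemma mem_coset [simp]: "y \<in> coset H x \<longleftrightarrow> y - x \<in> H"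
  by (simp add: coset_def)

lemma coset_eq_iff:
  assumes "add_subgroup H"
  shows "coset H x = coset H y \<longleftrightarrow> x - y \<in> H"
proof
  assume "coset H x = coset H y"
  moreover have "x \<in> coset H x"
    using assms by (simp add: add_subgroup_zero)
  ultimately show "x - y \<in> H"
    by simp
next
  assume *: "x - y \<in> H"
  have "z - x \<in> H \<longleftrightarrow> z - y \<in> H" for z
    using add_subgroup_add[OF assms _ *, of "z - x"] add_subgroup_diff[OF assms _ *, of "z - y"]
    by auto
  then show "coset H x = coset H y"
    by auto
qed

lemma coset_translate: "coset H (v + x) = (+) v ` coset H x"
proof -
  have "y \<in> (+) v ` coset H x" if "y - (v + x) \<in> H" for y
    by (rule image_eqI[of _ _ "y - v"]) (use that in \<open>auto simp: algebra_simps\<close>)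
  then show ?thesis
    by (auto simp: algebra_simps)
qed

lemma card_coset_translate: "card (coset H ` (+) v ` A) = card (coset H ` A)"
proof -
  have "coset H ` (+) v ` A = ((`) ((+) v)) ` coset H ` A"
    by (simp add: image_image coset_translate)
  moreover have "inj_on ((`) ((+) v)) (coset H ` A)"
    by (simp add: inj_on_def inj_image_eq_iff)
  ultimately show ?thesis
    by (simp add: card_image)
qed

section \<open>Subgroups of finite index\<close>

lemma finite_indexE:
  assumes "finite_index G H" "add_subgroup H"
  obtains F where "finite F" "F \<subseteq> G" "\<And>x. x \<in> G \<Longrightarrow> \<exists>f\<in>F. x - f \<in> H"
proof -
  from assms(1) obtain F where "F \<subseteq> G" "finite F" "coset H ` G = coset H ` F"
    unfolding finite_index_def by (metis finite_subset_image order_refl)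
  moreover from this have "\<exists>f\<in>F. x - f \<in> H" if "x \<in> G" for x
    using that coset_eq_iff[OF assms(2)] by (metis image_iff)
  ultimately show ?thesis
    using that by blast
qed

lemma finite_indexI:
  assumes "add_subgroup H" "finite F" "\<And>x. x \<in> G \<Longrightarrow> \<exists>f\<in>F. x - f \<in> H"
  shows "finite_index G H"
proof -
  have "coset H ` G \<subseteq> coset H ` F"
    using assms(3) coset_eq_iff[OF assms(1)] by blast
  with assms(2) show ?thesis
    unfolding finite_index_def by (meson finite_imageI finite_subset)
qed

text \<open>A coset of an intersection of two sets is the intersection of their cosets, so pairs of
  cosets bound the number.\<close>

lemma finite_index_Inter:
  assumes "finite \<H>" "\<And>H. H \<in> \<H> \<Longrightarrow> finite_index G H"
  shows "finite_index G (\<Inter>\<H>)"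
  using assms
proof (induction \<H> rule: finite_induct)
  case empty
  have "coset UNIV ` G \<subseteq> {UNIV}"
    by (auto simp: coset_def)
  then show ?case
    unfolding finite_index_def by (simp add: finite_subset)
next
  case (insert H \<H>)
  have "coset (H \<inter> \<Inter>\<H>) ` G \<subseteq> (\<lambda>(C, D). C \<inter> D) ` (coset H ` G \<times> coset (\<Inter>\<H>) ` G)"
  proof clarify
    fix x assume "x \<in> G"
    then show "coset (H \<inter> \<Inter>\<H>) x \<in> (\<lambda>(C, D). C \<inter> D) ` (coset H ` G \<times> coset (\<Inter>\<H>) ` G)"
      by (intro image_eqI[of _ _ "(coset H x, coset (\<Inter>\<H>) x)"]) auto
  qed
  moreover have "finite (coset H ` G \<times> coset (\<Inter>\<H>) ` G)"
    using insert by (auto simp: finite_index_def)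
  ultimately show ?case
    unfolding finite_index_def Inter_insert by (meson finite_imageI finite_subset)
qed

lemma finite_index_mono:
  assumes "finite_index G H" "add_subgroup H" "add_subgroup H'" "H \<subseteq> H'"
  shows "finite_index G H'"
proof -
  from assms(1,2) obtain F where "finite F" "\<And>x. x \<in> G \<Longrightarrow> \<exists>f\<in>F. x - f \<in> H"
    by (rule finite_indexE) blast
  with assms(3,4) show ?thesis
    by (intro finite_indexI) blast+
qed

text \<open>Such an \<open>M\<close> is the union of the cosets of \<open>H\<close> that it
  contains, hence determined by a set of cosets of \<open>H\<close>, of which there are finitely
  many.\<close>

lemma finite_intermediate_subgroups:
  assumes "finite_index G H" "add_subgroup H"
  shows "finite {M. add_subgroup M \<and> H \<subseteq> M \<and> M \<subseteq> G}"
proof (rule finite_subset)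
  show "{M. add_subgroup M \<and> H \<subseteq> M \<and> M \<subseteq> G} \<subseteq> Union ` Pow (coset H ` G)"
  proof clarify
    fix M assume M: "add_subgroup M" "H \<subseteq> M" "M \<subseteq> G"
    have "M = \<Union>(coset H ` M)"
    proof
      show "M \<subseteq> \<Union>(coset H ` M)"
        using add_subgroup_zero[OF assms(2)] by auto
      show "\<Union>(coset H ` M) \<subseteq> M"
        using M add_subgroup_add[OF M(1)] by clarsimp (metis diff_add_cancel subsetD)
    qed
    with M(3) show "M \<in> Union ` Pow (coset H ` G)"
      by blast
  qed
  show "finite (Union ` Pow (coset H ` G))"
    using assms(1) by (simp add: finite_index_def)
qed

text \<open>
  B. H. Neumann's lemma. If some coset of \<open>H\<close> is missing from the cover, it is covered by cosets of
  the other subgroups, and translates of these can replace all cosets of \<open>H\<close>.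
\<close>

lemma finite_index_of_coset_cover:
  assumes "finite \<H>" "\<And>H. H \<in> \<H> \<Longrightarrow> add_subgroup H" "add_subgroup G"
    and "finite C" "C \<subseteq> G \<times> \<H>" "\<And>x. x \<in> G \<Longrightarrow> \<exists>(a, H)\<in>C. x - a \<in> H"
  shows "\<exists>H\<in>\<H>. finite_index G H"
  using assms(1,2,4-)
proof (induction \<H> arbitrary: C rule: finite_induct)
  case empty
  then show ?case
    using add_subgroup_zero[OF assms(3)] by fastforce
next
  case (insert H \<H>)
  define F where "F = {a. (a, H) \<in> C}"
  have "F \<subseteq> fst ` C"
    by (force simp: F_def)
  then have F: "finite F" "F \<subseteq> G"
    using insert.prems(2,3) by (auto simp: F_def intro: finite_subset)
  have H: "add_subgroup H"
    using insert.prems(1) by auto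
  show ?case
  proof (cases "\<forall>x\<in>G. \<exists>f\<in>F. x - f \<in> H")
    case True
    then show ?thesis
      using finite_indexI[OF H F(1)] by blast
  next
    case False
    then obtain g where g: "g \<in> G" "\<And>f. f \<in> F \<Longrightarrow> g - f \<notin> H"
      by blast
    define C1 where "C1 = {c \<in> C. snd c \<noteq> H}"
    define C' where "C' = C1 \<union> (\<lambda>(f, a, M). (a - g + f, M)) ` (F \<times> C1)"
    have C1: "finite C1" "C1 \<subseteq> G \<times> \<H>"
      using insert.prems(2,3) by (auto simp: C1_def)
    have "\<exists>M\<in>\<H>. finite_index G M"
    proof (rule insert.IH)
      show "finite C'"
        using C1 F by (simp add: C'_def)
      have "a - g + f \<in> G" if "a \<in> G" "f \<in> G" for a f
        using that g(1) assms(3) by (intro add_subgroup_add add_subgroup_diff)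
      then show "C' \<subseteq> G \<times> \<H>"
        using C1(2) F(2) by (fastforce simp: C'_def)
      show "\<exists>(a, M)\<in>C'. x - a \<in> M" if x: "x \<in> G" for x
      proof -
        obtain a M where aM: "(a, M) \<in> C" "x - a \<in> M"
          using insert.prems(4)[OF x] by blast
        show ?thesis
        proof (cases "M = H")
          case False
          then show ?thesis
            using aM by (force simp: C'_def C1_def)
        next
          case True
          then have a: "a \<in> F" "a \<in> G"
            using aM F by (auto simp: F_def)
          \<comment> \<open>\<open>x - a + g\<close> lies in \<open>g + H\<close>, which no coset of
            \<open>H\<close> in the cover meets, so another subgroup \<open>N\<close> covers it;
            shifting back by \<open>a - g\<close> covers \<open>x\<close>.\<close>
          have "x - a + g \<in> G"
            using x a g(1) assms(3) by (intro add_subgroup_add add_subgroup_diff)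
          then obtain b N where bN: "(b, N) \<in> C" "x - a + g - b \<in> N"
            using insert.prems(4) by blast
          have "N \<noteq> H"
          proof
            assume "N = H"
            then have "(x - a + g - b) - (x - a) \<in> H" "b \<in> F"
              using add_subgroup_diff[OF H, of "x - a + g - b" "x - a"] bN aM True
              by (simp_all add: F_def)
            then show False
              using g(2)[of b] by simp
          qed
          then have "(b - g + a, N) \<in> C'"
            using bN a by (force simp: C'_def C1_def)
          moreover have "x - (b - g + a) \<in> N"
            using bN by (simp add: algebra_simps)
          ultimately show ?thesis
            by blast
        qed
      qed
    qed (use insert.prems in auto)
    then show ?thesis
      by blast
  qed
qed

text \<open>Suppose that \<open>I t\<close> has infinite index and let \<open>D\<close> be the
  intersection of all \<open>I s\<close> of finite index. If \<open>\<alpha> t\<close> lay in no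
  coset of such an \<open>I s\<close>, neither would any element of \<open>\<alpha> t + D\<close>;
  finitely many translates of the remaining cosets would then cover \<open>G\<close>, against
  Neumann's lemma. So \<open>\<alpha> t\<close> lies in a second coset of the cover, which exactness
  forbids.\<close>

lemma finite_index_of_exact_cover:
  assumes "finite T" and "add_subgroup G" and "\<And>t. t \<in> T \<Longrightarrow> add_subgroup (I t)"
    and "\<And>t. t \<in> T \<Longrightarrow> \<alpha> t \<in> G"
    and exact: "\<And>x. x \<in> G \<Longrightarrow> \<exists>!t. t \<in> T \<and> x - \<alpha> t \<in> I t" and "t \<in> T"
  shows "finite_index G (I t)"
proof (rule ccontr)
  define U where "U = {t \<in> T. finite_index G (I t)}"
  define D where "D = \<Inter>(I ` U)"
  assume nt: "\<not> finite_index G (I t)"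
  have D: "add_subgroup D" "finite_index G D"
    using assms(1,3) unfolding D_def
    by (auto simp: U_def intro!: add_subgroup_Inter finite_index_Inter)
  from D(2,1) obtain F where F: "finite F" "F \<subseteq> G" "\<And>x. x \<in> G \<Longrightarrow> \<exists>f\<in>F. x - f \<in> D"
    by (rule finite_indexE) blast
  have "\<exists>s\<in>U. \<alpha> t - \<alpha> s \<in> I s"
  proof (rule ccontr)
    assume no: "\<not> ?thesis"
    define g where "g = \<alpha> t"
    have g: "g \<in> G"
      using assms by (simp add: g_def)
    \<comment> \<open>The shift by \<open>f - g\<close> carries a cover of \<open>g + D\<close> to
      one of \<open>f + D\<close>, and the cosets \<open>f + D\<close> together cover
      \<open>G\<close>.\<close>
    define C where "C = (\<lambda>(f, s). (\<alpha> s - g + f, I s)) ` (F \<times> (T - U))"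
    have "\<exists>H\<in>I ` (T - U). finite_index G H"
    proof (rule finite_index_of_coset_cover)
      show "finite C"
        using F assms(1) by (simp add: C_def)
      have "\<alpha> s - g + f \<in> G" if "s \<in> T" "f \<in> F" for s f
        using that g assms(2,4) F(2) by (intro add_subgroup_add add_subgroup_diff) auto
      then show "C \<subseteq> G \<times> I ` (T - U)"
        by (auto simp: C_def)
      show "\<exists>(a, H)\<in>C. x - a \<in> H" if x: "x \<in> G" for x
      proof -
        obtain f where f: "f \<in> F" "x - f \<in> D"
          using F(3)[OF x] by blast
        have "x - f + g \<in> G"
          using x f F(2) g assms(2) by (intro add_subgroup_add add_subgroup_diff) auto
        then obtain s where s: "s \<in> T" "x - f + g - \<alpha> s \<in> I s"
          using exact by blast
        have "s \<notin> U"
        proof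
          assume sU: "s \<in> U"
          then have "x - f \<in> I s"
            using f by (auto simp: D_def)
          then have "(x - f + g - \<alpha> s) - (x - f) \<in> I s"
            by (rule add_subgroup_diff[OF assms(3)[OF s(1)] s(2)])
          then show False
            using no sU by (auto simp: g_def)
        qed
        then have "(\<alpha> s - g + f, I s) \<in> C"
          using f s by (force simp: C_def)
        moreover have "x - (\<alpha> s - g + f) \<in> I s"
          using s by (simp add: algebra_simps)
        ultimately show ?thesis
          by blast
      qed
    qed (use assms in auto)
    then show False
      by (auto simp: U_def)
  qed
  then obtain s where s: "s \<in> T" "finite_index G (I s)" "\<alpha> t - \<alpha> s \<in> I s"
    by (auto simp: U_def)
  moreover have "\<alpha> t - \<alpha> t \<in> I t"
    using assms(3,6) by (simp add: add_subgroup_zero)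
  ultimately have "s = t"
    using exact[of "\<alpha> t"] assms(4,6) by blast
  with s(2) nt show False
    by simp
qed

section \<open>Exact covers of subrings\<close>

text \<open>The subsets \<open>S\<close> and \<open>insert p S\<close> contribute opposite terms.
  This removes every function that inserting a single \<open>p\<close> leaves unchanged.\<close>

lemma alternating_sum_Pow_eq_0:
  fixes g :: "'b set \<Rightarrow> 'c::comm_ring_1"
  assumes "finite P" "p \<in> P" "\<And>S. S \<subseteq> P - {p} \<Longrightarrow> g (insert p S) = g S"
  shows "(\<Sum>S\<in>Pow P. (- 1) ^ card S * g S) = 0"
proof -
  define Q where "Q = P - {p}"
  have P: "P = insert p Q" "p \<notin> Q" "finite Q"
    using assms by (auto simp: Q_def)
  have inj: "inj_on (insert p) (Pow Q)"
    using P(2) by (auto simp: inj_on_def)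
  have "(\<Sum>S\<in>Pow P. (- 1) ^ card S * g S) =
      (\<Sum>S\<in>Pow Q. (- 1) ^ card S * g S) + (\<Sum>S\<in>insert p ` Pow Q. (- 1) ^ card S * g S)"
    unfolding P(1) Pow_insert using P by (intro sum.union_disjoint) auto
  also have "(\<Sum>S\<in>insert p ` Pow Q. (- 1) ^ card S * g S) =
      (\<Sum>S\<in>Pow Q. (- 1) ^ card (insert p S) * g (insert p S))"
    using inj by (simp add: sum.reindex)
  also have "\<dots> = (\<Sum>S\<in>Pow Q. - ((- 1) ^ card S * g S))"
  proof (rule sum.cong)
    fix S assume "S \<in> Pow Q"
    then have S: "S \<subseteq> Q" "p \<notin> S" "finite S"
      using P by (auto intro: finite_subset)
    then show "(- 1) ^ card (insert p S) * g (insert p S) = - ((- 1) ^ card S * g S)"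
      using assms(3)[of S] by (simp add: Q_def)
  qed simp
  finally show ?thesis
    by (simp add: sum_negf)
qed

text \<open>The ring is a subset of a ring type, so that its arithmetic is that of the type and the
  cosets above apply to its ideals.\<close>

locale subring_set =
  fixes R :: "'a::comm_ring_1 set"
  assumes add_subgroup_R: "add_subgroup R"
    and one_R: "1 \<in> R"
    and mult_R: "x \<in> R \<Longrightarrow> y \<in> R \<Longrightarrow> x * y \<in> R"
begin

definition is_ideal :: "'a set \<Rightarrow> bool"
  where "is_ideal J \<longleftrightarrow> J \<subseteq> R \<and> add_subgroup J \<and> (\<forall>r\<in>R. \<forall>x\<in>J. r * x \<in> J)"

definition is_prime :: "'a set \<Rightarrow> bool"
  where "is_prime p \<longleftrightarrow> is_ideal p \<and> 1 \<notin> p \<and> (\<forall>x\<in>R. \<forall>y\<in>R. x * y \<in> p \<longrightarrow> x \<in> p \<or> y \<in> p)"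

text \<open>The ideal quotient \<open>(J : b)\<close>, which is the annihilator of the class of
  \<open>b\<close> in \<open>R / J\<close>; the primes among these ideals are the associated primes
  of \<open>J\<close>.\<close>

definition colon :: "'a set \<Rightarrow> 'a \<Rightarrow> 'a set"
  where "colon J b = {x \<in> R. x * b \<in> J}"

lemma is_idealD:
  assumes "is_ideal J"
  shows "J \<subseteq> R" "add_subgroup J" "r \<in> R \<Longrightarrow> x \<in> J \<Longrightarrow> r * x \<in> J"
  using assms by (auto simp: is_ideal_def)

lemma is_primeD:
  assumes "is_prime p"
  shows "is_ideal p" "1 \<notin> p" "x \<in> R \<Longrightarrow> y \<in> R \<Longrightarrow> x * y \<in> p \<Longrightarrow> x \<in> p \<or> y \<in> p"
  using assms by (auto simp: is_prime_def)

lemma diff_R: "x \<in> R \<Longrightarrow> y \<in> R \<Longrightarrow> x - y \<in> R"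
  by (rule add_subgroup_diff[OF add_subgroup_R])

lemma power_R: "x \<in> R \<Longrightarrow> x ^ n \<in> R"
  by (induction n) (auto intro: one_R mult_R)

lemma prod_R: "(\<And>x. x \<in> A \<Longrightarrow> f x \<in> R) \<Longrightarrow> prod f A \<in> R"
  by (induction A rule: infinite_finite_induct) (auto intro: one_R mult_R)

lemma is_ideal_colon:
  assumes "is_ideal J" "b \<in> R"
  shows "is_ideal (colon J b)"
  unfolding is_ideal_def
proof (intro conjI ballI)
  show "add_subgroup (colon J b)"
    unfolding add_subgroup_def colon_def
    using add_subgroup_zero[OF add_subgroup_R] add_subgroup_zero[OF is_idealD(2)[OF assms(1)]]
      add_subgroup_diff[OF is_idealD(2)[OF assms(1)]]
    by (auto simp: left_diff_distrib diff_R)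
  show "r * x \<in> colon J b" if "r \<in> R" "x \<in> colon J b" for r x
    using that is_idealD(3)[OF assms(1)] by (auto simp: colon_def mult_R mult.assoc)
qed (auto simp: colon_def)

lemma subset_colon:
  assumes "is_ideal J" "b \<in> R"
  shows "J \<subseteq> colon J b"
  using assms is_idealD(3)[OF assms(1), of b] is_idealD(1)[OF assms(1)]
  by (auto simp: colon_def mult.commute)

lemma finite_ideals_above:
  assumes "is_ideal J" "finite_index R J"
  shows "finite {M. is_ideal M \<and> J \<subseteq> M}"
  by (rule finite_subset[OF _ finite_intermediate_subgroups[OF assms(2) is_idealD(2)[OF assms(1)]]])
    (auto simp: is_ideal_def)

section \<open>Prime ideals of finite index\<close>

lemma prime_power:
  assumes "is_prime p" "s \<in> R" "s \<notin> p"
  shows "s ^ n \<notin> p"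
proof (induction n)
  case (Suc n)
  then show ?case
    using is_primeD(3)[OF assms(1,2) power_R[OF assms(2)]] assms(3) by auto
qed (use is_primeD(2)[OF assms(1)] in simp)

lemma prime_prod:
  assumes "is_prime p" "\<And>x. x \<in> A \<Longrightarrow> f x \<in> R" "\<And>x. x \<in> A \<Longrightarrow> f x \<notin> p"
  shows "prod f A \<notin> p"
  using assms(2,3)
proof (induction A rule: infinite_finite_induct)
  case (insert x A)
  then show ?case
    using is_primeD(3)[OF assms(1), of "f x" "prod f A"] by (auto simp: prod_R)
qed (use is_primeD(2)[OF assms(1)] in auto)

text \<open>A finite domain is a field: two powers of \<open>s\<close> agree modulo \<open>p\<close>.\<close>

lemma prime_finite_index_inverse:
  assumes "is_prime p" "finite_index R p" "s \<in> R" "s \<notin> p"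
  obtains u where "u \<in> R" "1 - u * s \<in> p"
proof -
  note p = is_primeD[OF assms(1)]
  have "range (\<lambda>n. coset p (s ^ n)) \<subseteq> coset p ` R"
    using assms(3) by (auto simp: power_R)
  then have "finite (range (\<lambda>n. coset p (s ^ n)))"
    using assms(2) unfolding finite_index_def by (rule finite_subset)
  then have "\<not> inj (\<lambda>n::nat. coset p (s ^ n))"
    using finite_imageD infinite_UNIV_nat by blast
  then obtain m n :: nat where "m < n" "coset p (s ^ m) = coset p (s ^ n)"
    unfolding inj_def by (metis linorder_neqE_nat)
  then have "s ^ m - s ^ n \<in> p"
    using coset_eq_iff[OF is_idealD(2)[OF p(1)]] by blast
  moreover have "s ^ n = s ^ (m + Suc (n - m - 1))"
    using \<open>m < n\<close> by simp
  then have "s ^ n = s ^ m * (s ^ (n - m - 1) * s)"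
    by (simp only: power_add power_Suc2)
  then have "s ^ m - s ^ n = s ^ m * (1 - s ^ (n - m - 1) * s)"
    by (simp add: right_diff_distrib)
  \<comment> \<open>Cancelling \<open>s ^ m\<close>, which lies outside \<open>p\<close>, exhibits
    \<open>s ^ (n - m - 1)\<close> as an inverse of \<open>s\<close> modulo
    \<open>p\<close>.\<close>
  ultimately have "1 - s ^ (n - m - 1) * s \<in> p"
    using p(3)[of "s ^ m" "1 - s ^ (n - m - 1) * s"] prime_power[OF assms(1,3,4), of m] assms(3)
    by (auto simp: power_R diff_R one_R mult_R)
  then show ?thesis
    using that assms(3) by (meson power_R)
qed

text \<open>Primes of finite index are maximal: if \<open>q \<subseteq> p\<close>, an element of
  \<open>p\<close> outside \<open>q\<close> is invertible modulo \<open>q\<close>, which puts 1 into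
  \<open>p\<close>.\<close>

lemma prime_finite_index_not_subset:
  assumes "is_prime p" "is_prime q" "finite_index R q" "p \<noteq> q"
  shows "\<exists>s\<in>q. s \<notin> p"
proof (rule ccontr)
  assume "\<not> ?thesis"
  with assms(4) obtain s where s: "s \<in> p" "s \<notin> q" and qp: "q \<subseteq> p"
    by blast
  have sR: "s \<in> R"
    using s is_idealD(1)[OF is_primeD(1)[OF assms(1)]] by auto
  obtain u where u: "u \<in> R" "1 - u * s \<in> q"
    using prime_finite_index_inverse[OF assms(2,3) sR s(2)] .
  have "(1 - u * s) + u * s \<in> p"
    using u qp s is_idealD[OF is_primeD(1)[OF assms(1)]] by (intro add_subgroup_add) auto
  then show False
    using is_primeD(2)[OF assms(1)] by simp
qed

text \<open>An annihilator that is maximal among those of elements of \<open>J - I\<close> is prime.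
  Maximal ones exist because only finitely many ideals contain \<open>I\<close>.\<close>

lemma exists_associated_prime:
  assumes "is_ideal I" "finite_index R I" "is_ideal J" "\<not> J \<subseteq> I"
  obtains b where "b \<in> J" "b \<notin> I" "is_prime (colon I b)"
proof -
  define \<C> where "\<C> = colon I ` (J - I)"
  have JR: "J \<subseteq> R"
    using assms(3) by (rule is_idealD)
  have "\<C> \<subseteq> {M. is_ideal M \<and> I \<subseteq> M}"
    using is_ideal_colon[OF assms(1)] subset_colon[OF assms(1)] JR by (auto simp: \<C>_def)
  then have "finite \<C>"
    using finite_ideals_above[OF assms(1,2)] finite_subset by blast
  moreover have "\<C> \<noteq> {}"
    using assms(4) by (auto simp: \<C>_def)
  ultimately obtain M where "M \<in> \<C>" and max: "\<And>M'. M' \<in> \<C> \<Longrightarrow> M \<subseteq> M' \<Longrightarrow> M = M'"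
    using finite_has_maximal[of \<C>] by auto
  then obtain b where b: "b \<in> J" "b \<notin> I" "M = colon I b"
    by (auto simp: \<C>_def)
  have bR: "b \<in> R"
    using b JR by auto
  have "is_prime (colon I b)"
    unfolding is_prime_def
  proof (intro conjI ballI impI)
    show "is_ideal (colon I b)"
      using assms(1) bR by (rule is_ideal_colon)
    show "1 \<notin> colon I b"
      using b by (simp add: colon_def)
    fix x y assume xy: "x \<in> R" "y \<in> R" "x * y \<in> colon I b"
    show "x \<in> colon I b \<or> y \<in> colon I b"
    proof (cases "y * b \<in> I")
      case False
      \<comment> \<open>The annihilator of \<open>y * b\<close> contains that of \<open>b\<close>,
        so the two agree by maximality, and \<open>x\<close> belongs to the former.\<close>
      then have "colon I (y * b) \<in> \<C>"
        using xy b is_idealD(3)[OF assms(3)] by (auto simp: \<C>_def)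
      moreover have "M \<subseteq> colon I (y * b)"
        using is_idealD(3)[OF assms(1) xy(2)]
        by (auto simp: b colon_def mult.left_commute[of _ y])
      ultimately have "M = colon I (y * b)"
        by (rule max)
      moreover have "x \<in> colon I (y * b)"
        using xy by (auto simp: colon_def mult.assoc)
      ultimately show ?thesis
        using b by simp
    qed (use xy in \<open>simp add: colon_def\<close>)
  qed
  with b show ?thesis
    using that by blast
qed

text \<open>
  The localisation of \<open>R\<close> at \<open>p\<close> is a valuation ring, stated without fractions. It forces the
  \<open>p\<close>-part of the socle of \<open>R / I\<close> to be one-dimensional over \<open>R / p\<close>.
\<close>

definition chained_at :: "'a set \<Rightarrow> bool"
  where "chained_at p \<longleftrightarrow> (\<forall>a\<in>R. \<forall>b\<in>R. \<exists>s\<in>R - p. \<exists>r\<in>R. s * a = r * b \<or> s * b = r * a)"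

text \<open>As \<open>p\<close> annihilates \<open>a\<close> and \<open>b\<close> modulo
  \<open>I\<close>, only the classes of multipliers modulo \<open>p\<close> matter. If
  \<open>s * a = r * b\<close>, then \<open>s\<close> is inverted modulo \<open>p\<close>. If
  \<open>s * b = r * a\<close>, then \<open>r\<close> is outside \<open>p\<close> too, since
  otherwise \<open>s\<close> would annihilate \<open>b\<close>, and \<open>r\<close> is
  inverted.\<close>

lemma chained_at_socle:
  assumes "is_ideal I" "a \<in> R" "b \<in> R" "a \<notin> I" "colon I a = p" "colon I b = p"
    and "is_prime p" "finite_index R p" "chained_at p"
  obtains r where "r \<in> R" "a - r * b \<in> I"
proof -
  obtain s r where s: "s \<in> R" "s \<notin> p" "r \<in> R" and sr: "s * a = r * b \<or> s * b = r * a"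
    using assms(2,3,9) unfolding chained_at_def by blast
  have kill: "a - w * a \<in> I" if "1 - w \<in> p" for w
    using that assms(5) by (auto simp: colon_def left_diff_distrib)
  show ?thesis
  proof (cases "s * a = r * b")
    case True
    obtain u where u: "u \<in> R" "1 - u * s \<in> p"
      using prime_finite_index_inverse[OF assms(7,8) s(1,2)] .
    have "u * s * a = u * r * b"
      using True by (simp add: mult.assoc)
    then show ?thesis
      using that[of "u * r"] kill[OF u(2)] u(1) s(3) by (simp add: mult_R)
  next
    case False
    then have eq: "s * b = r * a"
      using sr by blast
    have "r \<notin> p"
      using s eq assms(5,6) by (metis (mono_tags, lifting) colon_def mem_Collect_eq)
    then obtain u where u: "u \<in> R" "1 - u * r \<in> p"
      using prime_finite_index_inverse[OF assms(7,8) s(3)] by blast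
    have "u * r * a = u * s * b"
      using eq by (simp add: mult.assoc)
    then show ?thesis
      using that[of "u * s"] kill[OF u(2)] u(1) s(1) by (simp add: mult_R)
  qed
qed

lemma finite_index_prime_above:
  assumes "is_ideal I" "finite_index R I" "is_ideal p" "I \<subseteq> p"
  shows "finite_index R p"
  using assms by (meson finite_index_mono is_idealD(2))

text \<open>
  Multiplying by some \<open>s p \<notin> p\<close> that lies in all other primes of \<open>P\<close> isolates the component at \<open>p\<close>,
  so each target \<open>d t\<close> excludes only one class of \<open>r p\<close> modulo \<open>p\<close>.
\<close>

lemma avoiding_socle_sums:
  fixes P :: "'a set set" and d :: "'b \<Rightarrow> 'a"
  assumes "is_ideal I" "finite P" "\<And>p. p \<in> P \<Longrightarrow> is_prime p" "\<And>p. p \<in> P \<Longrightarrow> finite_index R p"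
    and a: "\<And>p. p \<in> P \<Longrightarrow> a p \<in> R" "\<And>p. p \<in> P \<Longrightarrow> colon I (a p) = p"
    and "finite T" "\<And>t. t \<in> T \<Longrightarrow> d t \<in> R" "\<And>p. p \<in> P \<Longrightarrow> card T < card (coset p ` R)"
  obtains r where "\<And>p. p \<in> P \<Longrightarrow> r p \<in> R"
    and "\<And>S t. S \<subseteq> P \<Longrightarrow> S \<noteq> {} \<Longrightarrow> t \<in> T \<Longrightarrow> (\<Sum>p\<in>S. r p * a p) - d t \<notin> I"
proof -
  have IR: "I \<subseteq> R" "add_subgroup I" "\<And>r x. r \<in> R \<Longrightarrow> x \<in> I \<Longrightarrow> r * x \<in> I"
    using is_idealD[OF assms(1)] by auto
  have mem_p: "x \<in> p \<longleftrightarrow> x * a p \<in> I" if "p \<in> P" "x \<in> R" for p x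
    using a(2)[OF that(1)] that(2) by (auto simp: colon_def)
  have pR: "p \<subseteq> R" if "p \<in> P" for p
    using is_idealD(1)[OF is_primeD(1)[OF assms(3)[OF that]]] .
  have "\<exists>s. s \<in> R \<and> s \<notin> p \<and> (\<forall>q\<in>P - {p}. s \<in> q)" if p: "p \<in> P" for p
  proof -
    have "\<forall>q\<in>P - {p}. \<exists>s\<in>q. s \<notin> p"
      using p assms(3,4) by (auto intro!: prime_finite_index_not_subset)
    then obtain f where f: "\<And>q. q \<in> P - {p} \<Longrightarrow> f q \<in> q \<and> f q \<notin> p"
      by metis
    then have fR: "f q \<in> R" if "q \<in> P - {p}" for q
      using that pR by blast
    have "prod f (P - {p}) \<in> q" if q: "q \<in> P - {p}" for q
    proof -
      have "prod f (P - {p}) = prod f (P - {p} - {q}) * f q"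
        using q assms(2) by (subst prod.remove[of _ q]) (auto simp: mult.commute)
      then show ?thesis
        using is_idealD(3)[OF is_primeD(1)[OF assms(3)], of q "prod f (P - {p} - {q})" "f q"]
          prod_R[of "P - {p} - {q}" f] f[OF q] fR q by auto
    qed
    moreover have "prod f (P - {p}) \<notin> p"
      using f fR by (intro prime_prod assms p) auto
    ultimately show ?thesis
      using fR by (meson prod_R)
  qed
  then obtain s where s: "\<And>p. p \<in> P \<Longrightarrow> s p \<in> R" "\<And>p. p \<in> P \<Longrightarrow> s p \<notin> p"
    "\<And>p q. p \<in> P \<Longrightarrow> q \<in> P \<Longrightarrow> q \<noteq> p \<Longrightarrow> s p \<in> q"
    by (metis Diff_iff singletonD)
  have "\<exists>r\<in>R. \<forall>t\<in>T. s p * (r * a p) - s p * d t \<notin> I" if p: "p \<in> P" for p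
  proof (rule ccontr)
    assume "\<not> ?thesis"
    then have bad: "\<forall>r\<in>R. \<exists>t\<in>T. s p * (r * a p) - s p * d t \<in> I"
      by blast
    \<comment> \<open>Two values of \<open>r\<close> that fail for the same \<open>t\<close> agree
      modulo \<open>p\<close>, so the classes of \<open>rep t\<close> would exhaust the cosets of
      \<open>p\<close>, which outnumber \<open>T\<close>.\<close>
    define rep where "rep t = (SOME r. r \<in> R \<and> s p * (r * a p) - s p * d t \<in> I)" for t
    have "coset p ` R \<subseteq> (\<lambda>t. coset p (rep t)) ` T"
    proof clarify
      fix r assume r: "r \<in> R"
      then obtain t where t: "t \<in> T" "s p * (r * a p) - s p * d t \<in> I"
        using bad by blast
      have rep: "rep t \<in> R \<and> s p * (rep t * a p) - s p * d t \<in> I"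
        unfolding rep_def by (rule someI[of _ r]) (use r t in auto)
      have "(s p * (r * a p) - s p * d t) - (s p * (rep t * a p) - s p * d t) \<in> I"
        by (rule add_subgroup_diff[OF IR(2) t(2)]) (use rep in blast)
      then have "s p * (r - rep t) * a p \<in> I"
        by (simp add: algebra_simps)
      then have "s p * (r - rep t) \<in> p"
        using mem_p[OF p] s(1)[OF p] r rep by (auto simp: mult_R diff_R)
      then have "r - rep t \<in> p"
        using is_primeD(3)[OF assms(3)[OF p] s(1)[OF p] diff_R[OF r]] s(2)[OF p] rep by blast
      then have "coset p r = coset p (rep t)"
        using coset_eq_iff[OF is_idealD(2)[OF is_primeD(1)[OF assms(3)[OF p]]]] by blast
      then show "coset p r \<in> (\<lambda>t. coset p (rep t)) ` T"
        using t by blast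
    qed
    then have "card (coset p ` R) \<le> card T"
      using assms(7) by (meson card_image_le card_mono finite_imageI le_trans)
    then show False
      using assms(9)[OF p] by simp
  qed
  then obtain r where r: "\<And>p. p \<in> P \<Longrightarrow> r p \<in> R"
    "\<And>p t. p \<in> P \<Longrightarrow> t \<in> T \<Longrightarrow> s p * (r p * a p) - s p * d t \<notin> I"
    by metis
  have "(\<Sum>p\<in>S. r p * a p) - d t \<notin> I" if S: "S \<subseteq> P" "S \<noteq> {}" and t: "t \<in> T" for S t
  proof
    assume *: "(\<Sum>p\<in>S. r p * a p) - d t \<in> I"
    obtain p where p: "p \<in> S" "p \<in> P"
      using S by blast
    have fin: "finite S"
      using S assms(2) finite_subset by blast
    \<comment> \<open>For \<open>q \<noteq> p\<close>, \<open>s p\<close> lies in \<open>q\<close>,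
      the annihilator of \<open>a q\<close> modulo \<open>I\<close>.\<close>
    have "(\<Sum>q\<in>S - {p}. s p * (r q * a q)) \<in> I"
    proof (rule add_subgroup_sum[OF IR(2)])
      fix q assume "q \<in> S - {p}"
      then have q: "q \<in> P" "q \<noteq> p"
        using S by auto
      have "s p * a q \<in> I"
        using mem_p[OF q(1)] s(1,3) p q by blast
      then have "r q * (s p * a q) \<in> I"
        using IR(3) r(1) q by blast
      then show "s p * (r q * a q) \<in> I"
        by (simp add: mult.left_commute)
    qed
    moreover have "s p * ((\<Sum>p\<in>S. r p * a p) - d t) \<in> I"
      using * IR(3) s(1) p by blast
    ultimately have "s p * ((\<Sum>p\<in>S. r p * a p) - d t) - (\<Sum>q\<in>S - {p}. s p * (r q * a q)) \<in> I"
      using IR(2) by (intro add_subgroup_diff)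
    moreover have "s p * ((\<Sum>p\<in>S. r p * a p) - d t) - (\<Sum>q\<in>S - {p}. s p * (r q * a q)) =
        s p * (r p * a p) - s p * d t"
      using fin p by (simp add: sum.remove[of S p] algebra_simps sum_distrib_left)
    ultimately show False
      using r(2) p t by simp
  qed
  with r(1) show ?thesis
    using that by blast
qed

text \<open>This separates the covering argument from number theory, which enters only through
  \<open>chained\<close>; the norm of \<open>p\<close> appears as the number of its cosets in
  \<open>R\<close>.\<close>

theorem card_repeated_coset_ge:
  fixes T :: "'b set" and \<alpha> :: "'b \<Rightarrow> 'a" and I :: "'b \<Rightarrow> 'a set"
  assumes "finite T" and ideal_I: "\<And>t. t \<in> T \<Longrightarrow> is_ideal (I t)"
    and \<alpha>: "\<And>t. t \<in> T \<Longrightarrow> \<alpha> t \<in> R"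
    and exact: "\<And>x. x \<in> R \<Longrightarrow> \<exists>!t. t \<in> T \<and> x - \<alpha> t \<in> I t"
    and "i \<in> T" "I i \<noteq> R" and max: "\<And>t. t \<in> T \<Longrightarrow> I t \<subseteq> I i \<Longrightarrow> I t = I i"
    and chained: "\<And>p. is_prime p \<Longrightarrow> chained_at p"
  shows "\<exists>p. is_prime p \<and> I i \<subseteq> p \<and> card (coset p ` R) \<le> card {t \<in> T. I t = I i}"
proof (rule ccontr)
  assume contra: "\<not> ?thesis"
  define J where "J = I i"
  define T0 where "T0 = {t \<in> T. I t = J}"
  define L where "L = \<Inter>(I ` T)"
  define P where "P = {p. is_prime p \<and> (\<exists>a\<in>R. colon J a = p)}"
  have J: "is_ideal J" "add_subgroup J" "J \<subseteq> R"
    using ideal_I[OF \<open>i \<in> T\<close>] is_idealD by (auto simp: J_def)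
  have sub: "add_subgroup (I t)" if "t \<in> T" for t
    using ideal_I[OF that] by (rule is_idealD)
  have fin: "finite_index R (I t)" if "t \<in> T" for t
    by (rule finite_index_of_exact_cover[OF \<open>finite T\<close> add_subgroup_R sub \<alpha> exact that])
  have finJ: "finite_index R J"
    using fin[OF \<open>i \<in> T\<close>] by (simp add: J_def)
  have L: "add_subgroup L" "finite_index R L"
    using sub fin \<open>finite T\<close> by (auto simp: L_def intro!: add_subgroup_Inter finite_index_Inter)

  \<comment> \<open>Associated primes and socle elements\<close>
  have P_above: "is_ideal p \<and> J \<subseteq> p" if "p \<in> P" for p
    using that J(1) subset_colon is_primeD(1) by (auto simp: P_def)
  have finP: "finite P"
    by (rule finite_subset[OF _ finite_ideals_above[OF J(1) finJ]]) (use P_above in auto)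
  have P: "is_prime p" "finite_index R p" if "p \<in> P" for p
    using that P_above finite_index_prime_above[OF J(1) finJ] by (auto simp: P_def)
  obtain a where a: "\<And>p. p \<in> P \<Longrightarrow> a p \<in> R" "\<And>p. p \<in> P \<Longrightarrow> colon J (a p) = p"
  proof -
    have "\<forall>p\<in>P. \<exists>a. a \<in> R \<and> colon J a = p"
      by (auto simp: P_def)
    then show ?thesis
      using that by metis
  qed
  have aJ: "a p \<notin> J" if "p \<in> P" for p
  proof
    assume "a p \<in> J"
    then have "1 \<in> colon J (a p)"
      using one_R by (simp add: colon_def)
    then show False
      using a(2)[OF that] is_primeD(2)[OF P(1)[OF that]] by metis
  qed
  have norm: "card T0 < card (coset p ` R)" if "p \<in> P" for p
    using contra P(1)[OF that] P_above[OF that] by (auto simp: J_def T0_def not_le)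
  \<comment> \<open>With these targets, \<open>\<alpha> i + h S\<close>, for \<open>h\<close> as
    defined below, avoids every repeated coset \<open>\<alpha> t + J\<close> as soon as
    \<open>S\<close> is nonempty.\<close>
  obtain r where r: "\<And>p. p \<in> P \<Longrightarrow> r p \<in> R"
    and avoid: "\<And>S t. S \<subseteq> P \<Longrightarrow> S \<noteq> {} \<Longrightarrow> t \<in> T0 \<Longrightarrow> (\<Sum>p\<in>S. r p * a p) - (\<alpha> t - \<alpha> i) \<notin> J"
  proof (rule avoiding_socle_sums[OF J(1) finP P a])
    show "finite T0" "\<And>t. t \<in> T0 \<Longrightarrow> \<alpha> t - \<alpha> i \<in> R"
      using \<open>finite T\<close> \<alpha> \<open>i \<in> T\<close> by (auto simp: T0_def diff_R)
  qed (use norm in auto)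
  define h where "h S = (\<Sum>p\<in>S. r p * a p)" for S
  have hR: "h S \<in> R" if "S \<subseteq> P" for S
    unfolding h_def by (rule add_subgroup_sum[OF add_subgroup_R]) (use that r a in \<open>auto simp: mult_R\<close>)

  \<comment> \<open>A suitable \<open>b\<close> in \<open>M\<close> has a prime annihilator
    \<open>p\<close> modulo \<open>J\<close>. By one-dimensionality \<open>a p\<close> is a multiple
    of \<open>b\<close> modulo \<open>J\<close>, and so is \<open>r p * a p\<close>.\<close>
  have meets: "\<exists>p\<in>P. \<exists>u\<in>J. \<exists>v\<in>M. r p * a p = u + v" if M: "is_ideal M" "\<not> M \<subseteq> J" for M
  proof -
    obtain b where b: "b \<in> M" "b \<notin> J" "is_prime (colon J b)"
      using exists_associated_prime[OF J(1) finJ M] .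
    define p where "p = colon J b"
    have bR: "b \<in> R"
      using b(1) M(1) is_idealD(1) by blast
    have p: "p \<in> P"
      using b(3) bR by (auto simp: P_def p_def)
    obtain c where c: "c \<in> R" "a p - c * b \<in> J"
      using chained_at_socle[OF J(1) a(1)[OF p] bR aJ[OF p] a(2)[OF p] p_def[symmetric] P[OF p]
          chained[OF P(1)[OF p]]] .
    have "r p * a p = r p * (a p - c * b) + r p * c * b"
      by (simp add: algebra_simps)
    moreover have "r p * (a p - c * b) \<in> J" "r p * c * b \<in> M"
      using c r[OF p] b is_idealD(3)[OF J(1)] is_idealD(3)[OF M(1)] by (auto simp: mult_R)
    ultimately show ?thesis
      using p by blast
  qed

  \<comment> \<open>Counting cosets of \<open>L\<close>\<close>
  define A where "A t x = {z. z - x \<in> J \<and> z - \<alpha> t \<in> I t}" for t x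
  \<comment> \<open>For \<open>t\<close> in \<open>T\<close>, \<open>A t x\<close> is a union of
    cosets of \<open>L\<close>, because \<open>L\<close> lies in \<open>J\<close> and in
    \<open>I t\<close>. Finite index of \<open>L\<close> makes the count meaningful.\<close>
  define F where "F t x = int (card (coset L ` A t x))" for t x
  define c where "c = int (card (coset L ` J))"
  have A_R: "A t x \<subseteq> R" if "x \<in> R" for t x
  proof
    fix z assume "z \<in> A t x"
    then have "(z - x) + x \<in> R"
      using J(3) that add_subgroup_R by (intro add_subgroup_add) (auto simp: A_def)
    then show "z \<in> R"
      by simp
  qed
  have finL: "finite (coset L ` B)" if "B \<subseteq> R" for B
    using L(2) that unfolding finite_index_def by (meson finite_subset image_mono)
  have "c > 0"
    using finL[OF J(3)] add_subgroup_zero[OF J(2)] by (auto simp: c_def card_gt_0_iff)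

  have F_shift: "F t (x + (u + v)) = F t x" if t: "t \<in> T" and uv: "u \<in> J" "v \<in> I t" for t x u v
  proof -
    \<comment> \<open>\<open>u\<close> does not affect the coset of \<open>J\<close>, and
      translation by \<open>v\<close> preserves \<open>\<alpha> t + I t\<close>.\<close>
    have "A t (x + (u + v)) = (+) v ` A t x"
    proof (intro Set.set_eqI iffI)
      fix z assume "z \<in> A t (x + (u + v))"
      then have z: "z - (x + (u + v)) \<in> J" "z - \<alpha> t \<in> I t"
        by (auto simp: A_def)
      have "z - v \<in> A t x"
        using add_subgroup_add[OF J(2) z(1) uv(1)] add_subgroup_diff[OF sub[OF t] z(2) uv(2)]
        by (simp add: A_def algebra_simps)
      then show "z \<in> (+) v ` A t x"
        by (rule rev_image_eqI) simp
    next
      fix z assume "z \<in> (+) v ` A t x"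
      then obtain y where y: "y - x \<in> J" "y - \<alpha> t \<in> I t" "z = v + y"
        by (auto simp: A_def)
      then show "z \<in> A t (x + (u + v))"
        using add_subgroup_diff[OF J(2) y(1) uv(1)] add_subgroup_add[OF sub[OF t] y(2) uv(2)]
        by (simp add: A_def algebra_simps)
    qed
    then show ?thesis
      by (simp add: F_def card_coset_translate)
  qed

  have coset_J: "{z. z - x \<in> J} = (+) x ` J" for x
    by (force intro: image_eqI[of _ _ "z - x" for z])
  have F_T0: "F t x = (if x - \<alpha> t \<in> J then c else 0)" if t: "t \<in> T0" for t x
  proof (cases "x - \<alpha> t \<in> J")
    case True
    have "z - \<alpha> t \<in> J" if "z - x \<in> J" for z
      using add_subgroup_add[OF J(2) that True] by simp
    then have "A t x = (+) x ` J"
      using t by (auto simp: A_def T0_def simp flip: coset_J)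
    then show ?thesis
      using True by (simp add: F_def c_def card_coset_translate)
  next
    case False
    have "A t x = {}"
    proof (rule ccontr)
      assume "A t x \<noteq> {}"
      then obtain z where "z - \<alpha> t \<in> J" "z - x \<in> J"
        using t by (auto simp: A_def T0_def)
      then have "(z - \<alpha> t) - (z - x) \<in> J"
        by (rule add_subgroup_diff[OF J(2)])
      with False show False
        by simp
    qed
    with False show ?thesis
      by (simp add: F_def)
  qed

  have F_sum: "(\<Sum>t\<in>T. F t x) = c" if x: "x \<in> R" for x
  proof -
    \<comment> \<open>\<open>L\<close> lies in \<open>I t\<close>, so a coset of \<open>L\<close>
      shared by \<open>A s x\<close> and \<open>A t x\<close> would put a single element into two
      cosets of the cover.\<close>
    have disj: "coset L ` A s x \<inter> coset L ` A t x = {}" if "s \<in> T" "t \<in> T" "s \<noteq> t" for s t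
    proof (rule ccontr)
      assume "\<not> ?thesis"
      then obtain y z where yz: "y \<in> A s x" "z \<in> A t x" "coset L y = coset L z"
        by blast
      then have "y - z \<in> I t"
        using coset_eq_iff[OF L(1)] that(2) by (auto simp: L_def)
      then have "(y - z) + (z - \<alpha> t) \<in> I t"
        using yz(2) sub[OF that(2)] by (intro add_subgroup_add) (auto simp: A_def)
      then have "y - \<alpha> t \<in> I t" "y - \<alpha> s \<in> I s" "y \<in> R"
        using yz(1) A_R[OF x] by (auto simp: A_def)
      with exact that show False
        by blast
    qed
    have "(\<Sum>t\<in>T. F t x) = int (card (\<Union>t\<in>T. coset L ` A t x))"
      using disj \<open>finite T\<close> A_R[OF x] finL by (subst card_UN_disjoint) (auto simp: F_def)
    also have "(\<Union>t\<in>T. coset L ` A t x) = coset L ` (+) x ` J"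
    proof -
      have "(\<Union>t\<in>T. A t x) = {z. z - x \<in> J}"
      proof (intro Set.set_eqI iffI)
        fix z assume "z \<in> {z. z - x \<in> J}"
        then have z: "z - x \<in> J"
          by simp
        then have "(z - x) + x \<in> R"
          using x J(3) add_subgroup_R by (intro add_subgroup_add) auto
        then have "z \<in> R"
          by simp
        then obtain t where "t \<in> T" "z - \<alpha> t \<in> I t"
          using exact by blast
        then show "z \<in> (\<Union>t\<in>T. A t x)"
          using z by (auto simp: A_def)
      qed (auto simp: A_def)
      then show ?thesis
        by (simp add: coset_J flip: image_UN)
    qed
    finally show ?thesis
      by (simp add: c_def card_coset_translate)
  qed

  \<comment> \<open>Alternating sums over sets of primes\<close>
  define alt where "alt g = (\<Sum>S\<in>Pow P. (- 1) ^ card S * g S)" for g :: "'a set set \<Rightarrow> int"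
  have h_insert: "h (insert p S) = h S + r p * a p" if "p \<in> P" "S \<subseteq> P - {p}" for p S
  proof -
    have "finite S" "p \<notin> S"
      using that finP by (auto intro: finite_subset)
    then show ?thesis
      by (simp add: h_def add.commute)
  qed
  have alt_other: "alt (\<lambda>S. F t (\<alpha> i + h S)) = 0" if t: "t \<in> T" "t \<notin> T0" for t
  proof -
    \<comment> \<open>By maximality of \<open>J\<close>, the sum \<open>J + I t\<close> contains
      some \<open>r p * a p\<close>; inserting this \<open>p\<close> into \<open>S\<close> then
      shifts the argument of \<open>F t\<close> by a period.\<close>
    have "\<not> I t \<subseteq> J"
      using t max by (auto simp: T0_def J_def)
    then obtain p u v where p: "p \<in> P" and uv: "u \<in> J" "v \<in> I t" "r p * a p = u + v"
      using meets[OF ideal_I[OF t(1)]] by blast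
    show ?thesis
      unfolding alt_def
    proof (rule alternating_sum_Pow_eq_0[OF finP p])
      fix S assume "S \<subseteq> P - {p}"
      then show "F t (\<alpha> i + h (insert p S)) = F t (\<alpha> i + h S)"
        using F_shift[OF t(1) uv(1,2), of "\<alpha> i + h S"] h_insert[OF p] uv(3)
        by (simp add: add.assoc)
    qed
  qed
  have alt_T0: "alt (\<lambda>S. F t (\<alpha> i + h S)) = (if t = i then c else 0)" if t: "t \<in> T0" for t
  proof -
    have tT: "t \<in> T" "I t = J"
      using t by (auto simp: T0_def)
    \<comment> \<open>The choice of \<open>r\<close> leaves only the term of the empty set, where
      \<open>h\<close> vanishes.\<close>
    have "alt (\<lambda>S. F t (\<alpha> i + h S)) = (\<Sum>S\<in>{{}}. (- 1) ^ card S * F t (\<alpha> i + h S))"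
      unfolding alt_def
    proof (rule sum.mono_neutral_right)
      show "\<forall>S\<in>Pow P - {{}}. (- 1) ^ card S * F t (\<alpha> i + h S) = 0"
      proof
        fix S assume "S \<in> Pow P - {{}}"
        then have "\<alpha> i + h S - \<alpha> t \<notin> J"
          using avoid[of S t] t by (auto simp: h_def algebra_simps)
        then show "(- 1) ^ card S * F t (\<alpha> i + h S) = 0"
          using F_T0[OF t] by simp
      qed
    qed (use finP in auto)
    also have "\<dots> = F t (\<alpha> i)"
      by (simp add: h_def)
    also have "\<dots> = (if t = i then c else 0)"
    proof (cases "t = i")
      case True
      then show ?thesis
        using F_T0[OF t] add_subgroup_zero[OF J(2)] by simp
    next
      case False
      have "\<alpha> i - \<alpha> i \<in> I i"
        using add_subgroup_zero[OF J(2)] by (simp add: J_def)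
      then have "\<alpha> i - \<alpha> t \<notin> J"
        using exact[OF \<alpha>[OF \<open>i \<in> T\<close>]] False tT \<open>i \<in> T\<close> by metis
      then show ?thesis
        using F_T0[OF t] False by simp
    qed
    finally show ?thesis .
  qed
  \<comment> \<open>\<open>R\<close> itself is an ideal not contained in the proper ideal
    \<open>J\<close>. With some \<open>p\<close> in \<open>P\<close>, the alternating sum of a
    constant vanishes.\<close>
  have "\<exists>p. p \<in> P"
    using meets[of R] J(3) \<open>I i \<noteq> R\<close> add_subgroup_R
    by (auto simp: is_ideal_def mult_R J_def)
  then obtain p where p: "p \<in> P" ..
  have "0 = alt (\<lambda>S. c)"
    unfolding alt_def by (rule alternating_sum_Pow_eq_0[OF finP p, symmetric]) simp
  also have "\<dots> = alt (\<lambda>S. \<Sum>t\<in>T. F t (\<alpha> i + h S))"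
    unfolding alt_def using F_sum hR \<alpha>[OF \<open>i \<in> T\<close>] add_subgroup_R
    by (intro sum.cong refl) (auto simp: add_subgroup_add)
  also have "\<dots> = (\<Sum>t\<in>T. alt (\<lambda>S. F t (\<alpha> i + h S)))"
    unfolding alt_def sum_distrib_left by (rule sum.swap)
  also have "\<dots> = (\<Sum>t\<in>T. if t = i then c else 0)"
  proof (rule sum.cong)
    fix t assume "t \<in> T"
    moreover have "i \<in> T0"
      using \<open>i \<in> T\<close> by (simp add: T0_def J_def)
    ultimately show "alt (\<lambda>S. F t (\<alpha> i + h S)) = (if t = i then c else 0)"
      using alt_T0 alt_other by (cases "t \<in> T0") auto
  qed simp
  also have "\<dots> = c"
    using \<open>finite T\<close> \<open>i \<in> T\<close> by simp
  finally show False
    using \<open>c > 0\<close> by simp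
qed

end

section \<open>Rings of integers\<close>

text \<open>The vector \<open>v\<close> is an eigenvector of the integer matrix \<open>A\<close>, so
  \<open>y\<close> is a root of its characteristic polynomial, which is monic with integer
  coefficients.\<close>

lemma algebraic_int_if_int_eigenvalue:
  fixes y :: "'a::field_char_0" and v :: "nat \<Rightarrow> 'a" and A :: "nat \<Rightarrow> nat \<Rightarrow> int"
  assumes "\<And>j. j < n \<Longrightarrow> y * v j = (\<Sum>m<n. of_int (A j m) * v m)" and "j < n" "v j \<noteq> 0"
  shows "algebraic_int y"
proof -
  define M where "M = mat n n (\<lambda>(j, m). A j m)"
  have M: "M \<in> carrier_mat n n"
    by (simp add: M_def)
  define M' where "M' = (map_mat of_int M :: 'a mat)"
  have M': "M' \<in> carrier_mat n n"
    using M by (simp add: M'_def)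
  have "eigenvector M' (vec n v) y"
    unfolding eigenvector_def
  proof (intro conjI)
    show "vec n v \<noteq> 0\<^sub>v (dim_row M')"
    proof
      assume "vec n v = 0\<^sub>v (dim_row M')"
      then have "vec n v $ j = 0\<^sub>v n $ j"
        using M' by simp
      then show False
        using assms(2,3) by simp
    qed
    show "M' *\<^sub>v vec n v = y \<cdot>\<^sub>v vec n v"
      by (rule eq_vecI)
        (auto simp: M'_def M_def scalar_prod_def assms(1) atLeast0LessThan intro!: sum.cong)
  qed (use M' in auto)
  then have "poly (char_poly M') y = 0"
    using eigenvalue_root_char_poly[OF M'] by (auto simp: eigenvalue_def)
  moreover have "char_poly M' = map_poly of_int (char_poly M)"
    unfolding M'_def by (rule of_int_hom.char_poly_hom[OF M])
  moreover have "lead_coeff (char_poly M) = 1"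
    using degree_monic_char_poly[OF M] by simp
  ultimately show ?thesis
    unfolding algebraic_int_altdef_ipoly by metis
qed

text \<open>
  For a root \<open>x\<close> of an integer polynomial \<open>q\<close> of degree \<open>n\<close>, multiplication by the Horner partial
  sum below preserves the lattice spanned by \<open>1, x, \<dots>, x ^ (n - 1)\<close>: if \<open>k \<le> j\<close>, then
  \<open>q(x) = 0\<close> rewrites its product with \<open>x ^ j\<close> in terms of the low coefficients of \<open>q\<close>.
\<close>

definition horner_part :: "int poly \<Rightarrow> 'a::field_char_0 \<Rightarrow> nat \<Rightarrow> 'a"
  where "horner_part q x k = (\<Sum>l=k..degree q. of_int (coeff q l) * x ^ (l - k))"

lemma horner_part_step:
  assumes "k \<le> degree q"
  shows "horner_part q x k = of_int (coeff q k) + x * horner_part q x (Suc k)"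
proof -
  have "horner_part q x k = of_int (coeff q k) +
      (\<Sum>l=Suc k..degree q. of_int (coeff q l) * x ^ (l - k))"
    unfolding horner_part_def using assms by (subst sum.atLeast_Suc_atMost) auto
  also have "(\<Sum>l=Suc k..degree q. of_int (coeff q l) * x ^ (l - k)) = x * horner_part q x (Suc k)"
    unfolding horner_part_def sum_distrib_left
  proof (rule sum.cong)
    fix l assume "l \<in> {Suc k..degree q}"
    then have "l - k = Suc (l - Suc k)"
      by auto
    then show "of_int (coeff q l) * x ^ (l - k) = x * (of_int (coeff q l) * x ^ (l - Suc k))"
      by simp
  qed simp
  finally show ?thesis .
qed

lemma algebraic_int_horner_part:
  fixes x :: "'a::field_char_0"
  assumes root: "poly (map_poly of_int q) x = 0" and "degree q > 0"
  shows "algebraic_int (horner_part q x k)"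
proof -
  define n where "n = degree q"
  have q0: "(\<Sum>l\<le>n. of_int (coeff q l) * x ^ l) = 0"
    using root by (simp add: poly_altdef coeff_map_poly n_def)
  \<comment> \<open>Row \<open>j\<close> expresses \<open>horner_part q x k * x ^ j\<close> in
    powers below \<open>n\<close>. For \<open>j < k\<close> the exponents \<open>l - k + j\<close>
    stay below \<open>n\<close>; for \<open>k \<le> j\<close> the terms \<open>l < k\<close> with
    opposite sign take over and yield exponents from \<open>j - k\<close> to
    \<open>j - 1\<close>.\<close>
  define A where "A j m =
    (if k \<le> j then (if j \<le> m + k \<and> m < j then - coeff q (m + k - j) else 0)
     else (if j \<le> m then coeff q (m + k - j) else 0))" for j m
  \<comment> \<open>The entry \<open>x ^ 0 = 1\<close> shows that the vector is nonzero; index 0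
    exists since \<open>n > 0\<close>.\<close>
  show ?thesis
  proof (rule algebraic_int_if_int_eigenvalue[of n _ "\<lambda>j. x ^ j" A 0])
    fix j assume j: "j < n"
    show "horner_part q x k * x ^ j = (\<Sum>m<n. of_int (A j m) * x ^ m)"
    proof (cases "k \<le> j")
      case True
      have "horner_part q x k * x ^ j = (\<Sum>l=k..n. of_int (coeff q l) * x ^ l) * x ^ (j - k)"
        unfolding horner_part_def n_def[symmetric] sum_distrib_right
      proof (rule sum.cong)
        fix l assume "l \<in> {k..n}"
        then have "l - k + j = l + (j - k)"
          using True by auto
        then show "of_int (coeff q l) * x ^ (l - k) * x ^ j = of_int (coeff q l) * x ^ l * x ^ (j - k)"
          by (simp add: mult.assoc flip: power_add)
      qed simp
      also have "(\<Sum>l=k..n. of_int (coeff q l) * x ^ l) = - (\<Sum>l<k. of_int (coeff q l) * x ^ l)"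
      proof -
        have "{..n} = {..<k} \<union> {k..n}"
          using True j by auto
        then show ?thesis
          using q0 by (simp add: sum.union_disjoint ivl_disj_int eq_neg_iff_add_eq_0 add.commute)
      qed
      also have "\<dots> * x ^ (j - k) = (\<Sum>l<k. of_int (- coeff q l) * x ^ (l + (j - k)))"
        by (simp add: sum_negf sum_distrib_right mult.assoc power_add)
      also have "\<dots> = (\<Sum>m=j - k..<j. of_int (- coeff q (m + k - j)) * x ^ m)"
        by (rule sum.reindex_bij_witness[of _ "\<lambda>m. m - (j - k)" "\<lambda>l. l + (j - k)"])
          (use True in auto)
      also have "\<dots> = (\<Sum>m<n. of_int (A j m) * x ^ m)"
        by (rule sum.mono_neutral_cong_left) (use True j in \<open>auto simp: A_def\<close>)
      finally show ?thesis .
    next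
      case False
      have "horner_part q x k * x ^ j = (\<Sum>l=k..n. of_int (coeff q l) * x ^ (l - k + j))"
        unfolding horner_part_def n_def by (simp add: sum_distrib_right mult.assoc flip: power_add)
      also have "\<dots> = (\<Sum>m=j..<n + j + 1 - k. of_int (coeff q (m + k - j)) * x ^ m)"
        by (rule sum.reindex_bij_witness[of _ "\<lambda>m. m + k - j" "\<lambda>l. l - k + j"])
          (use False in auto)
      \<comment> \<open>Entries with \<open>m + k - j > n\<close> vanish, being coefficients beyond
        the degree.\<close>
      also have "\<dots> = (\<Sum>m<n. of_int (A j m) * x ^ m)"
        by (rule sum.mono_neutral_cong_left)
          (use False j in \<open>auto simp: A_def n_def intro!: coeff_eq_0\<close>)
      finally show ?thesis .
    qed
  qed (use assms in \<open>auto simp: n_def\<close>)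
qed

section \<open>Field types as rings of HOL-Algebra, and algebraicity of number fields\<close>

lemma type_algebra_simps:
  "carrier (ring_of_type_algebra :: 'a::field ring) = UNIV"
  "x \<otimes>\<^bsub>ring_of_type_algebra\<^esub> y = x * y" "x \<oplus>\<^bsub>ring_of_type_algebra\<^esub> y = x + y"
  "\<zero>\<^bsub>ring_of_type_algebra\<^esub> = (0 :: 'a)" "\<one>\<^bsub>ring_of_type_algebra\<^esub> = (1 :: 'a)"
  for x y :: "'a::field"
  by (auto simp: ring_of_type_algebra_def)

lemma type_algebra_uminus: "\<ominus>\<^bsub>ring_of_type_algebra\<^esub> x = - x" for x :: "'a::field"
proof -
  interpret field "ring_of_type_algebra :: 'a ring"
    by (rule field_from_type_algebra)
  show ?thesis
    by (rule minus_equality) (auto simp: type_algebra_simps)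
qed

lemma type_algebra_inv:
  fixes x :: "'a::field"
  assumes "x \<noteq> 0"
  shows "inv\<^bsub>ring_of_type_algebra\<^esub> x = inverse x"
proof -
  interpret field "ring_of_type_algebra :: 'a ring"
    by (rule field_from_type_algebra)
  show ?thesis
    using assms by (intro comm_inv_char) (auto simp: type_algebra_simps)
qed

lemma type_algebra_power: "x [^]\<^bsub>ring_of_type_algebra\<^esub> (n::nat) = x ^ n" for x :: "'a::field"
proof -
  interpret field "ring_of_type_algebra :: 'a ring"
    by (rule field_from_type_algebra)
  show ?thesis
    by (induction n) (auto simp: type_algebra_simps)
qed

lemma number_field_imp_algebraic:
  fixes x :: "'a::field_char_0"
  assumes "number_field K" "x \<in> K"
  shows "Polynomial.algebraic x"
proof -
  define L where "L = (ring_of_type_algebra :: 'a ring)"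
  interpret L: field L
    unfolding L_def by (rule field_from_type_algebra)
  have K: "subfield K L" "L.finite_dimension \<rat> K"
    using assms(1) by (auto simp: number_field_def L_def)
  note L_simps = type_algebra_simps[where 'a = 'a, folded L_def]
    and L_power = type_algebra_power[where 'a = 'a, folded L_def]
  have Q: "subfield \<rat> L"
  proof (rule L.subfieldI')
    show "subring \<rat> L"
      by (rule L.subringI) (auto simp: L_simps type_algebra_uminus[where 'a = 'a, folded L_def])
    show "inv\<^bsub>L\<^esub> k \<in> \<rat>" if "k \<in> \<rat> - {\<zero>\<^bsub>L\<^esub>}" for k
      using that by (simp add: L_simps type_algebra_inv[where 'a = 'a, folded L_def])
  qed
  have "(L.algebraic over \<rat>) x"
    using L.finite_dimension_imp_algebraic[OF Q subfieldE(1)[OF K(1)] K(2) assms(2)] .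
  then obtain p where p: "p \<in> carrier (\<rat>[X]\<^bsub>L\<^esub>)" "p \<noteq> []" "L.eval p x = \<zero>\<^bsub>L\<^esub>"
    using L.algebraicE[OF subfieldE(1)[OF Q]] by (metis UNIV_I L_simps(1))
  \<comment> \<open>HOL-Algebra lists coefficients from the leading one down, hence
    \<open>rev\<close>; the nonzero head of the list later shows that the polynomial is
    nonzero.\<close>
  have eval: "L.eval p x = poly (Poly (rev p)) x" for p
    by (induction p) (auto simp: L_simps L_power Poly_append poly_monom)
  have p': "set p \<subseteq> \<rat>" "hd p \<noteq> 0"
    using p(1,2) by (auto simp: univ_poly_def polynomial_def L_simps)
  show ?thesis
    unfolding algebraic_altdef
  proof (intro exI conjI allI)
    show "poly (Poly (rev p)) x = 0"
      using p(3) by (simp add: eval L_simps)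
    show "Polynomial.coeff (Poly (rev p)) m \<in> \<rat>" for m
      using p'(1) nth_mem[of m "rev p"] by (auto simp: nth_default_def)
    have "Polynomial.coeff (Poly (rev p)) (length p - 1) = hd p"
      using p(2) by (simp add: nth_default_def rev_nth hd_conv_nth)
    then show "Poly (rev p) \<noteq> 0"
      using p'(2) by force
  qed
qed

lemma subfield_type_algebra:
  fixes K :: "'a::field set"
  assumes "subfield K ring_of_type_algebra"
  shows "x \<in> K \<Longrightarrow> y \<in> K \<Longrightarrow> x + y \<in> K" "x \<in> K \<Longrightarrow> y \<in> K \<Longrightarrow> x * y \<in> K"
    "x \<in> K \<Longrightarrow> - x \<in> K" "0 \<in> K" "1 \<in> K" "x \<in> K \<Longrightarrow> inverse x \<in> K"
proof -
  interpret field "ring_of_type_algebra :: 'a ring"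
    by (rule field_from_type_algebra)
  note sub = subringE[OF subfieldE(1)[OF assms], unfolded type_algebra_simps type_algebra_uminus]
  show "x \<in> K \<Longrightarrow> y \<in> K \<Longrightarrow> x + y \<in> K" "x \<in> K \<Longrightarrow> y \<in> K \<Longrightarrow> x * y \<in> K"
    "x \<in> K \<Longrightarrow> - x \<in> K" "0 \<in> K" "1 \<in> K"
    using sub by auto
  \<comment> \<open>For \<open>x = 0\<close> the convention \<open>inverse 0 = 0\<close>
    applies.\<close>
  show "inverse x \<in> K" if "x \<in> K"
    using subfield_m_inv(1)[OF assms, of x] that sub
    by (cases "x = 0") (auto simp: type_algebra_simps type_algebra_inv)
qed

text \<open>By Bezout each gcd is an integer combination. Applied to the integers whose image lies
  in a prime \<open>p\<close>, this gives a polynomial of content 1 a coefficient outside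
  \<open>p\<close>.\<close>

lemma gcd_list_in_int_ideal:
  fixes H :: "int set"
  assumes "0 \<in> H" "\<And>a b. a \<in> H \<Longrightarrow> b \<in> H \<Longrightarrow> a + b \<in> H" "\<And>a c. a \<in> H \<Longrightarrow> c * a \<in> H"
    and "set cs \<subseteq> H"
  shows "gcd_list cs \<in> H"
  using assms(4)
proof (induction cs)
  case (Cons c cs)
  obtain u v where "u * c + v * gcd_list cs = gcd c (gcd_list cs)"
    using bezout_int by blast
  moreover have "u * c + v * gcd_list cs \<in> H"
    using Cons assms(2,3) by simp
  ultimately show ?case
    by simp
qed (use assms(1) in simp)

lemma of_int_mem_subfield:
  fixes K :: "'a::field set"
  assumes "subfield K ring_of_type_algebra"
  shows "of_int n \<in> K"
proof -
  have "of_nat m \<in> K" for m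
    by (induction m) (auto intro: subfield_type_algebra[OF assms])
  then show ?thesis
    by (cases n) (auto intro: subfield_type_algebra(3)[OF assms] simp del: of_nat_Suc)
qed

text \<open>
  That the integers of \<open>K\<close> form a ring need not be proved: the predicate \<open>ideal\<close> in the definition of
  an exact covering system already includes it.
\<close>

locale number_field_integers =
  fixes K :: "'a::field_char_0 set"
  assumes nf: "number_field K" and ring_OK: "ring (ring_of_integers K)"
begin

abbreviation OK :: "'a set"
  where "OK \<equiv> {x \<in> K. algebraic_int x}"

lemma subfield_K: "subfield K ring_of_type_algebra"
  using nf by (simp add: number_field_def)

lemma ring_of_integers_simps:
  "carrier (ring_of_integers K) = OK" "\<zero>\<^bsub>ring_of_integers K\<^esub> = 0" "\<one>\<^bsub>ring_of_integers K\<^esub> = 1"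
  "x \<otimes>\<^bsub>ring_of_integers K\<^esub> y = x * y" "x \<oplus>\<^bsub>ring_of_integers K\<^esub> y = x + y"
  by (auto simp: ring_of_integers_def ring_of_type_algebra_def)

sublocale subring_set OK
proof
  interpret ring "ring_of_integers K"
    by (rule ring_OK)
  show "x * y \<in> OK" if "x \<in> OK" "y \<in> OK" for x y
    using m_closed that unfolding ring_of_integers_simps by blast
  show "1 \<in> OK"
    using one_closed unfolding ring_of_integers_simps by blast
  have "x - y \<in> OK" if "x \<in> OK" "y \<in> OK" for x y
  proof -
    have "- y \<in> OK"
      using that(2) subfield_type_algebra(3)[OF subfield_K] by auto
    then show ?thesis
      using add.m_closed[of x "- y"] that(1) unfolding ring_of_integers_simps by simp
  qed
  moreover have "0 \<in> OK"
    using zero_closed unfolding ring_of_integers_simps by blast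
  ultimately show "add_subgroup OK"
    by (auto simp: add_subgroup_def)
qed

lemma of_int_OK: "of_int n \<in> OK"
  using of_int_mem_subfield[OF subfield_K] by (auto intro: int_imp_algebraic_int)

text \<open>For \<open>b \<noteq> 0\<close> and \<open>x = a / b\<close>, some coefficient of a
  primitive integer polynomial with root \<open>x\<close> lies outside \<open>p\<close>. It equals
  \<open>y k - x * y (Suc k)\<close>, where both terms are integers of \<open>K\<close>, so one of
  them lies outside \<open>p\<close> and serves as \<open>s\<close>.\<close>

lemma prime_chained_at:
  assumes "is_prime p"
  shows "chained_at p"
  unfolding chained_at_def
proof (intro ballI)
  fix a b assume ab: "a \<in> OK" "b \<in> OK"
  note p = is_primeD[OF assms] and pI = is_idealD[OF is_primeD(1)[OF assms]]
  show "\<exists>s\<in>OK - p. \<exists>r\<in>OK. s * a = r * b \<or> s * b = r * a"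
  proof (cases "b = 0")
    case True
    then show ?thesis
      using p(2) one_R add_subgroup_zero[OF add_subgroup_R]
      by (intro bexI[of _ 1] bexI[of _ 0]) auto
  next
    case False
    define x where "x = a / b"
    have a: "a = x * b"
      using False by (simp add: x_def)
    have "x \<in> K"
      using ab subfield_type_algebra(2,6)[OF subfield_K] by (auto simp: x_def divide_inverse)
    then have "Polynomial.algebraic x"
      by (rule number_field_imp_algebraic[OF nf])
    then obtain q0 where q0: "q0 \<noteq> 0" "poly (map_poly of_int q0) x = 0"
      by (auto elim: algebraicE')
    define q where "q = primitive_part q0"
    have "poly (map_poly of_int q) x = 0" (is "?e q = 0")
    proof -
      have "?e q0 = of_int (content q0) * ?e q"
        by (subst content_times_primitive_part[of q0, symmetric])
          (simp add: of_int_hom.map_poly_hom_smult q_def del: content_times_primitive_part)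
      then show ?thesis
        using q0 by simp
    qed
    note q = this
    have "content q = 1"
      using q0(1) by (simp add: q_def)
    have "q \<noteq> 0"
      using q0(1) by (simp add: q_def)
    have deg: "Polynomial.degree q > 0"
    proof (rule ccontr)
      assume "\<not> ?thesis"
      then obtain c where "q = [:c:]"
        using degree_eq_zeroE by blast
      then show False
        using q \<open>q \<noteq> 0\<close> by (simp add: map_poly_pCons)
    qed
    have "\<exists>k. of_int (Polynomial.coeff q k) \<notin> p"
    proof (rule ccontr)
      assume "\<not> ?thesis"
      then have "set (coeffs q) \<subseteq> {c. of_int c \<in> p}"
        by (auto simp: coeffs_def)
      then have "gcd_list (coeffs q) \<in> {c. of_int c \<in> p}"
        using add_subgroup_zero[OF pI(2)] add_subgroup_add[OF pI(2)] pI(3)[OF of_int_OK]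
        by (intro gcd_list_in_int_ideal) auto
      then show False
        using \<open>content q = 1\<close> p(2) by (simp add: content_def)
    qed
    then obtain k where k: "of_int (Polynomial.coeff q k) \<notin> p"
      by blast
    have kd: "k \<le> Polynomial.degree q"
      using k add_subgroup_zero[OF pI(2)] by (metis coeff_eq_0 not_le of_int_0)
    define y where "y = horner_part q x"
    have yK: "y j \<in> K" for j
    proof -
      have pow: "x ^ m \<in> K" for m
        by (induction m) (auto intro: subfield_type_algebra[OF subfield_K] \<open>x \<in> K\<close>)
      have sum_K: "sum f A \<in> K" if "\<And>l. f l \<in> K" for f :: "nat \<Rightarrow> 'a" and A
        by (induction A rule: infinite_finite_induct)
          (auto intro: subfield_type_algebra[OF subfield_K] that)
      show ?thesis
        unfolding y_def horner_part_def
        by (intro sum_K subfield_type_algebra(2)[OF subfield_K] of_int_mem_subfield[OF subfield_K] pow)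
    qed
    have y: "y j \<in> OK" for j
      using algebraic_int_horner_part[OF q deg] yK by (simp add: y_def)
    have step: "y j = of_int (Polynomial.coeff q j) + x * y (Suc j)" if "j \<le> Polynomial.degree q" for j
      unfolding y_def by (rule horner_part_step[OF that])
    have xy: "x * y (Suc j) \<in> OK" if "j \<le> Polynomial.degree q" for j
      using diff_R[OF y[of j] of_int_OK[of "Polynomial.coeff q j"]] step[OF that] by simp
    \<comment> \<open>\<open>y 0\<close> is the value of \<open>q\<close> at \<open>x\<close>. Hence
      \<open>k \<noteq> 0\<close> if \<open>y k\<close> is outside \<open>p\<close>, and the
      previous index gives \<open>x * y k \<in> OK\<close>.\<close>
    have y0: "y 0 = 0"
      using q by (simp add: y_def horner_part_def poly_altdef coeff_map_poly atMost_atLeast0)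
    have "y k \<notin> p \<or> x * y (Suc k) \<notin> p"
    proof (rule ccontr)
      assume "\<not> ?thesis"
      then have "y k - x * y (Suc k) \<in> p"
        by (intro add_subgroup_diff[OF pI(2)]) auto
      then show False
        using k step[OF kd] by simp
    qed
    then show ?thesis
    proof
      assume yk: "y k \<notin> p"
      then have "k \<noteq> 0"
        using y0 add_subgroup_zero[OF pI(2)] by metis
      then have "x * y k \<in> OK"
        using xy[of "k - 1"] kd by simp
      moreover have "y k * a = (x * y k) * b"
        by (simp add: a)
      ultimately show ?thesis
        using yk y[of k] by blast
    next
      assume "x * y (Suc k) \<notin> p"
      moreover have "(x * y (Suc k)) * b = y (Suc k) * a"
        by (simp add: a)
      ultimately show ?thesis
        using xy[OF kd] y[of "Suc k"] by blast
    qed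
  qed
qed

section \<open>Ideals, primes and norms in the ring of integers\<close>

lemma ideal_imp_is_ideal:
  assumes "ideal J (ring_of_integers K)"
  shows "is_ideal J"
proof -
  interpret ideal J "ring_of_integers K"
    by (rule assms)
  have J: "J \<subseteq> OK"
    using a_subset unfolding ring_of_integers_simps .
  have mult: "r * x \<in> J" if "r \<in> OK" "x \<in> J" for r x
    using I_l_closed[of x r] that unfolding ring_of_integers_simps by blast
  have "x - y \<in> J" if "x \<in> J" "y \<in> J" for x y
  proof -
    have "(- 1) * y \<in> J"
      using mult[OF of_int_OK[of "- 1"] that(2)] by simp
    then show ?thesis
      using additive_subgroup.a_closed[OF additive_subgroup_axioms that(1), of "- y"]
      unfolding ring_of_integers_simps by simp
  qed
  moreover have "0 \<in> J"
    using additive_subgroup.zero_closed[OF additive_subgroup_axioms] unfolding ring_of_integers_simps .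
  ultimately show ?thesis
    using J mult by (auto simp: is_ideal_def add_subgroup_def)
qed

text \<open>From right to left this puts the prime found by counting among those whose norms are
  minimised; from left to right it helps to show that there are only finitely many of these.\<close>

lemma primeideal_iff_is_prime: "primeideal p (ring_of_integers K) \<longleftrightarrow> is_prime p"
proof
  assume *: "primeideal p (ring_of_integers K)"
  then interpret primeideal p "ring_of_integers K" .
  have p: "is_ideal p"
    by (rule ideal_imp_is_ideal) (rule ideal_axioms)
  have "1 \<notin> p"
    using one_imp_carrier I_notcarr unfolding ring_of_integers_simps by blast
  then show "is_prime p"
    using p I_prime unfolding is_prime_def ring_of_integers_simps by blast
next
  assume p: "is_prime p"
  note pI = is_idealD[OF is_primeD(1)[OF p]]
  interpret ring "ring_of_integers K"
    by (rule ring_OK)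
  interpret cring "ring_of_integers K"
    by unfold_locales (simp add: ring_of_integers_simps mult.commute)
  show "primeideal p (ring_of_integers K)"
  proof (rule primeidealI)
    show "ideal p (ring_of_integers K)"
    proof (rule idealI[OF ring_OK])
      have inv: "inv\<^bsub>add_monoid (ring_of_integers K)\<^esub> x = - x" if "x \<in> p" for x
      proof -
        have "\<ominus>\<^bsub>ring_of_integers K\<^esub> x = - x"
          using that pI add_subgroup_uminus[OF pI(2)]
          by (intro minus_equality) (auto simp: ring_of_integers_simps)
        then show ?thesis
          by (simp add: a_inv_def)
      qed
      show "subgroup p (add_monoid (ring_of_integers K))"
        by (rule add.subgroupI)
          (use pI(1) add_subgroup_zero[OF pI(2)] add_subgroup_add[OF pI(2)]
            add_subgroup_uminus[OF pI(2)] inv in \<open>auto simp: ring_of_integers_simps a_inv_def\<close>)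
      show "x \<otimes>\<^bsub>ring_of_integers K\<^esub> a \<in> p" "a \<otimes>\<^bsub>ring_of_integers K\<^esub> x \<in> p"
        if "a \<in> p" "x \<in> carrier (ring_of_integers K)" for a x
        using pI(3)[of x a] that unfolding ring_of_integers_simps by (simp_all add: mult.commute)
    qed
    show "carrier (ring_of_integers K) \<noteq> p"
      using is_primeD(2)[OF p] one_R unfolding ring_of_integers_simps by blast
    show "x \<in> p \<or> y \<in> p"
      if "x \<in> carrier (ring_of_integers K)" "y \<in> carrier (ring_of_integers K)"
        "x \<otimes>\<^bsub>ring_of_integers K\<^esub> y \<in> p" for x y
      using is_primeD(3)[OF p] that unfolding ring_of_integers_simps by blast
  qed (rule is_cring)
qed

lemma coset_eq_l_coset: "x <+\<^bsub>ring_of_integers K\<^esub> J = coset J x"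
proof -
  have "y \<in> coset J x \<longleftrightarrow> (\<exists>h\<in>J. y = x + h)" for y
    by (auto intro: bexI[of _ "y - x"])
  then show ?thesis
    by (auto simp: a_l_coset_def' ring_of_integers_simps)
qed

lemma ideal_norm_eq: "ideal_norm (ring_of_integers K) J = card (coset J ` OK)"
proof -
  have "J +>\<^bsub>ring_of_integers K\<^esub> x = coset J x" for x
    unfolding coset_eq_l_coset[symmetric] a_l_coset_def' a_r_coset_def'
    by (simp add: ring_of_integers_simps add.commute)
  then have "a_rcosets\<^bsub>ring_of_integers K\<^esub> J = coset J ` OK"
    by (auto simp: A_RCOSETS_def' ring_of_integers_simps)
  then show ?thesis
    by (simp add: ideal_norm_def FactRing_def)
qed

end

theorem theorem1:
  fixes K :: "'a::field_char_0 set" and k i :: nat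
    and \<alpha> :: "nat \<Rightarrow> 'a" and I :: "nat \<Rightarrow> 'a set"
  assumes "number_field K"
    and "exact_covering_system (ring_of_integers K) k \<alpha> I"
    and "i \<in> {1..k}"
    and "division_maximal (I i) (I ` {1..k})"
  shows "card {t \<in> {1..k}. I t = I i} \<ge>
    Min {ideal_norm (ring_of_integers K) p | p.
      primeideal p (ring_of_integers K) \<and> ideal_dvd p (I i)}"
proof -
  note cov = assms(2)[unfolded exact_covering_system_def]
  have ideal_I: "ideal (I t) (ring_of_integers K)" if "t \<in> {1..k}" for t
    using cov that by blast
  interpret number_field_integers K
    by (rule number_field_integers.intro[OF assms(1) ideal.axioms(2)[OF ideal_I[OF assms(3)]]])
  have is_ideal_I: "is_ideal (I t)" if "t \<in> {1..k}" for t
    using ideal_I[OF that] by (rule ideal_imp_is_ideal)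
  have \<alpha>: "\<alpha> t \<in> OK" if "t \<in> {1..k}" for t
    using cov that unfolding ring_of_integers_simps by blast
  have exact: "\<exists>!t. t \<in> {1..k} \<and> x - \<alpha> t \<in> I t" if "x \<in> OK" for x
    using cov that unfolding ring_of_integers_simps coset_eq_l_coset mem_coset by blast
  have "I i \<noteq> OK"
    using cov assms(3) unfolding ring_of_integers_simps by blast
  moreover have "I t = I i" if "t \<in> {1..k}" "I t \<subseteq> I i" for t
    using assms(4) that unfolding division_maximal_def ideal_dvd_def by blast
  ultimately obtain p where p: "is_prime p" "I i \<subseteq> p"
    "card (coset p ` OK) \<le> card {t \<in> {1..k}. I t = I i}"
    using card_repeated_coset_ge[OF _ is_ideal_I \<alpha> exact assms(3) _ _ prime_chained_at] by blast
  let ?N = "{ideal_norm (ring_of_integers K) p | p.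
    primeideal p (ring_of_integers K) \<and> ideal_dvd p (I i)}"
  \<comment> \<open>\<open>Min\<close> is specified only for finite nonempty sets. The set of norms
    is finite because \<open>I i\<close> has finite index, so that only finitely many ideals contain
    it.\<close>
  have "finite_index OK (I i)"
    by (rule finite_index_of_exact_cover[OF _ add_subgroup_R is_idealD(2)[OF is_ideal_I] \<alpha> exact assms(3)])
      auto
  then have "finite {M. is_ideal M \<and> I i \<subseteq> M}"
    by (rule finite_ideals_above[OF is_ideal_I[OF assms(3)]])
  then have "finite (ideal_norm (ring_of_integers K) ` {M. is_ideal M \<and> I i \<subseteq> M})"
    by (rule finite_imageI)
  then have "finite ?N"
    by (rule rev_finite_subset)
      (auto simp: primeideal_iff_is_prime ideal_dvd_def dest: is_primeD(1))
  moreover have "ideal_norm (ring_of_integers K) p \<in> ?N"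
    using p(1,2) by (auto simp: primeideal_iff_is_prime ideal_dvd_def)
  ultimately have "Min ?N \<le> ideal_norm (ring_of_integers K) p"
    by (rule Min_le)
  also have "\<dots> \<le> card {t \<in> {1..k}. I t = I i}"
    using p(3) by (simp add: ideal_norm_eq)
  finally show ?thesis .
qed

end
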